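(* Let $(f,s)\colon(\gamma,x_0)\to(\delta,y_0)$ be a based cellular morphism between based cellular automata $\gamma\colon X\to CX$, $\delta\colon Y\to CY$. Then $s\colon X^*\to Y^*$ is a logical transport $(\gamma,x_0)\rightsquigarrow(\delta,y_0)$, i.e. for every modal formula $\varphi$ and every $c\in X^*$: $(\gamma,x_0,c)\models\varphi$ iff $(\delta,y_0,s(c))\models\varphi$.
   Context: Fix a monoid $(M,\cdot,e)$, a subset $N\subseteq M$ with inclusion $i\colon N\hookrightarrow M$, and a set $S$ of states. $[A,B]$ is the set of maps $A\to B$. For $a\colon M\to X$ let $I^a\subseteq[N,S]$ be the set of $f\colon N\to S$ with $f(n)=f(n')$ whenever $a(i(n))=a(i(n'))$; for $h\colon X\to Y$, $I^{h\circ a}\subseteq I^a$. Let $CX=\coprod_{a\colon M\to X}[I^a,S]$, $(Ch)(a,f)=(h\circ a, f|_{I^{h\circ a}})$. A cellular automaton is $\gamma\colon X\to CX$, $\gamma(x)=(\gamma_1(x),\gamma_2(x))$ with $\gamma_1(x)\colon M\to X$, $\gamma_2(x)\colon I^{\gamma_1(x)}\to S$, such that $\gamma_1(x)(e)=x$ and $\gamma_1(\gamma_1(x)(m))(n)=\gamma_1(x)(n\cdot m)$. A pre-cellular morphism $h\colon\gamma\to\delta$ is a map with $Ch\circ\gamma=\delta\circ h$. Configurations: $X^*=[X,S]$; $h^*(c)=c\circ h$. Global rule $G_\gamma(c)(x)=\gamma_2(x)(c\circ\gamma_1(x)\circ i)$. A cellular morphism $\gamma\to\delta$ is a pair $(f,s)$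 with $f\colon X\to Y$ pre-cellular and $s\colon X^*\to Y^*$ satisfying $f^*\circ s=\mathrm{id}$; it is based $(\gamma,x_0)\to(\delta,y_0)$ if $f(x_0)=y_0$. Modal formulas: $\varphi::=s\mid\neg\varphi\mid\bigvee_{j\in J}\varphi_j\mid\langle m\rangle\varphi\mid\bigcirc\varphi$ ($s\in S$, $m\in M$, $J$ arbitrary index set). Semantics: $(\gamma,x,c)\models s$ iff $c(x)=s$; $\neg,\bigvee$ classical; $(\gamma,x,c)\models\langle m\rangle\varphi$ iff $(\gamma,\gamma_1(x)(m),c)\models\varphi$; $(\gamma,x,c)\models\bigcirc\varphi$ iff $(\gamma,x,G_\gamma(c))\models\varphi$. *)

theory Defs
  imports Main "HOL-Library.FuncSet"
begin

text \<open>
  The monoid \<open>M\<close> is the type \<open>'m\<close>, the states \<open>S\<close> are the type \<open>'s\<close>, and \<open>N\<close> is a set of type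
  \<open>'m set\<close>, possibly empty. Maps defined on a proper subset (on \<open>N\<close>, or on a set of maps
  \<open>N \<rightarrow> S\<close>) are represented by extensional functions, so that equality of functions is
  equality of maps on the given domain; restriction along the inclusion of \<open>N\<close> is \<open>restrict _ N\<close>.
\<close>

definition local_configs :: "'m set \<Rightarrow> ('m \<Rightarrow> 'x) \<Rightarrow> ('m \<Rightarrow> 's) set" where
  "local_configs N a =
     {f \<in> N \<rightarrow>\<^sub>E UNIV. \<forall>n\<in>N. \<forall>n'\<in>N. a n = a n' \<longrightarrow> f n = f n'}"

lemma local_configs_comp_subset:
  fixes a :: "'m \<Rightarrow> 'x" and h :: "'x \<Rightarrow> 'y"
  shows "(local_configs N (h \<circ> a) :: ('m \<Rightarrow> 's) set) \<subseteq> local_configs N a"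
proof
  fix f :: "'m \<Rightarrow> 's"
  assume f: "f \<in> local_configs N (h \<circ> a)"
  have "f n = f n'" if "n \<in> N" "n' \<in> N" "a n = a n'" for n n'
  proof -
    have "(h \<circ> a) n = (h \<circ> a) n'" using that(3) by simp
    with f that(1,2) show ?thesis unfolding local_configs_def by blast
  qed
  with f show "f \<in> local_configs N a" unfolding local_configs_def by blast
qed

type_synonym ('m, 'x, 's) cell = "('m \<Rightarrow> 'x) \<times> (('m \<Rightarrow> 's) \<Rightarrow> 's)"

definition cells :: "'m set \<Rightarrow> ('m, 'x, 's) cell set" where
  "cells N = (SIGMA a:UNIV. local_configs N a \<rightarrow>\<^sub>E UNIV)"

definition map_cell :: "'m set \<Rightarrow> ('x \<Rightarrow> 'y) \<Rightarrow> ('m, 'x, 's) cell \<Rightarrow> ('m, 'y, 's) cell" where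
  "map_cell N h = (\<lambda>(a, f). (h \<circ> a, restrict f (local_configs N (h \<circ> a))))"

lemma map_cell_in_cells: "p \<in> cells N \<Longrightarrow> map_cell N h p \<in> cells N"
  by (auto simp: cells_def map_cell_def)

definition cellular_automaton ::
  "('m::monoid_mult) set \<Rightarrow> ('x \<Rightarrow> ('m, 'x, 's) cell) \<Rightarrow> bool" where
  "cellular_automaton N \<gamma> \<longleftrightarrow>
     (\<forall>x. \<gamma> x \<in> cells N) \<and>
     (\<forall>x. fst (\<gamma> x) 1 = x) \<and>
     (\<forall>x m n. fst (\<gamma> (fst (\<gamma> x) m)) n = fst (\<gamma> x) (n * m))"

definition pre_cellular_morphism ::
  "'m set \<Rightarrow> ('x \<Rightarrow> ('m, 'x, 's) cell) \<Rightarrow> ('y \<Rightarrow> ('m, 'y, 's) cell) \<Rightarrow> ('x \<Rightarrow> 'y) \<Rightarrow> bool" where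
  "pre_cellular_morphism N \<gamma> \<delta> h \<longleftrightarrow> map_cell N h \<circ> \<gamma> = \<delta> \<circ> h"

type_synonym ('x, 's) config = "'x \<Rightarrow> 's"

definition pullback :: "('x \<Rightarrow> 'y) \<Rightarrow> ('y, 's) config \<Rightarrow> ('x, 's) config" where
  "pullback h c = c \<circ> h"

definition global_rule ::
  "'m set \<Rightarrow> ('x \<Rightarrow> ('m, 'x, 's) cell) \<Rightarrow> ('x, 's) config \<Rightarrow> ('x, 's) config" where
  "global_rule N \<gamma> c x = snd (\<gamma> x) (restrict (c \<circ> fst (\<gamma> x)) N)"

definition cellular_morphism ::
  "'m set \<Rightarrow> ('x \<Rightarrow> ('m, 'x, 's) cell) \<Rightarrow> ('y \<Rightarrow> ('m, 'y, 's) cell) \<Rightarrow>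
   ('x \<Rightarrow> 'y) \<times> (('x, 's) config \<Rightarrow> ('y, 's) config) \<Rightarrow> bool" where
  "cellular_morphism N \<gamma> \<delta> = (\<lambda>(f, s). pre_cellular_morphism N \<gamma> \<delta> f \<and> pullback f \<circ> s = id)"

definition based_cellular_morphism ::
  "'m set \<Rightarrow> ('x \<Rightarrow> ('m, 'x, 's) cell) \<times> 'x \<Rightarrow> ('y \<Rightarrow> ('m, 'y, 's) cell) \<times> 'y \<Rightarrow>
   ('x \<Rightarrow> 'y) \<times> (('x, 's) config \<Rightarrow> ('y, 's) config) \<Rightarrow> bool" where
  "based_cellular_morphism N = (\<lambda>(\<gamma>, x0) (\<delta>, y0) (f, s).
     cellular_morphism N \<gamma> \<delta> (f, s) \<and> f x0 = y0)"

text \<open>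
  In \<open>Disj J \<phi>\<close> the index set \<open>J\<close> is an arbitrary, possibly empty or infinite, subset of the type
  \<open>'j\<close>; values of \<open>\<phi>\<close> outside \<open>J\<close> are irrelevant. A single formula uses only a set of indices, so
  every formula with arbitrary index sets is expressible for a large enough \<open>'j\<close>.
\<close>

datatype ('s, 'm, 'j) modal_formula =
    State 's
  | Neg "('s, 'm, 'j) modal_formula"
  | Disj "'j set" "'j \<Rightarrow> ('s, 'm, 'j) modal_formula"
  | Dia 'm "('s, 'm, 'j) modal_formula"
  | Next "('s, 'm, 'j) modal_formula"

primrec satisfies ::
  "'m set \<Rightarrow> ('x \<Rightarrow> ('m, 'x, 's) cell) \<Rightarrow> ('s, 'm, 'j) modal_formula \<Rightarrow>
   'x \<Rightarrow> ('x, 's) config \<Rightarrow> bool" where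
  "satisfies N \<gamma> (State s) = (\<lambda>x c. c x = s)"
| "satisfies N \<gamma> (Neg \<phi>) = (\<lambda>x c. \<not> satisfies N \<gamma> \<phi> x c)"
| "satisfies N \<gamma> (Disj J \<phi>) = (\<lambda>x c. \<exists>j\<in>J. satisfies N \<gamma> (\<phi> j) x c)"
| "satisfies N \<gamma> (Dia m \<phi>) = (\<lambda>x c. satisfies N \<gamma> \<phi> (fst (\<gamma> x) m) c)"
| "satisfies N \<gamma> (Next \<phi>) = (\<lambda>x c. satisfies N \<gamma> \<phi> x (global_rule N \<gamma> c))"

text \<open>
  The phantom argument \<open>TYPE('j)\<close> fixes the type from which index sets of disjunctions are drawn.
\<close>

definition logical_transport ::
  "'j itself \<Rightarrow> 'm set \<Rightarrow> ('x \<Rightarrow> ('m, 'x, 's) cell) \<times> 'x \<Rightarrow> ('y \<Rightarrow> ('m, 'y, 's) cell) \<times> 'y \<Rightarrow>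
   (('x, 's) config \<Rightarrow> ('y, 's) config) \<Rightarrow> bool" where
  "logical_transport _ N = (\<lambda>(\<gamma>, x0) (\<delta>, y0) s.
     \<forall>(\<phi> :: ('s, 'm, 'j) modal_formula) c.
       satisfies N \<gamma> \<phi> x0 c \<longleftrightarrow> satisfies N \<delta> \<phi> y0 (s c))"

end

theory Submission imports Defs begin

text \<open>
  A configuration \<open>c\<close> of \<open>\<gamma>\<close> is the pullback \<open>s c \<circ> f\<close>. Since the pullback along a pre-cellular
  morphism commutes with the global rules, a formula holds at \<open>x\<close> in a pulled-back configuration
  \<open>d \<circ> f\<close> iff it holds at \<open>f x\<close> in \<open>d\<close>. Arguing with \<open>d\<close> instead of \<open>s\<close> matters for the modality
  \<open>Next\<close>: \<open>s\<close> itself need not commute with the global rules.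
\<close>

lemma pre_cellular_morphism_apply:
  assumes "pre_cellular_morphism N \<gamma> \<delta> f"
  shows "\<delta> (f x) = (f \<circ> fst (\<gamma> x), restrict (snd (\<gamma> x)) (local_configs N (f \<circ> fst (\<gamma> x))))"
  using fun_cong[OF assms[unfolded pre_cellular_morphism_def], of x]
  by (simp add: map_cell_def case_prod_beta)

lemma restrict_comp_in_local_configs: "restrict (d \<circ> a) N \<in> local_configs N a"
  by (auto simp: local_configs_def)

lemma global_rule_pullback:
  assumes "pre_cellular_morphism N \<gamma> \<delta> f"
  shows "global_rule N \<gamma> (pullback f d) = pullback f (global_rule N \<delta> d)"
proof
  fix x
  \<comment> \<open>Both local rules read this same pattern. The rule of \<open>\<delta>\<close> at
    \<open>f x\<close> is that of \<open>\<gamma>\<close> at \<open>x\<close> cut down to this set,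
    so membership is what makes the two values agree.\<close>
  have "restrict (d \<circ> f \<circ> fst (\<gamma> x)) N \<in> local_configs N (f \<circ> fst (\<gamma> x))"
    unfolding o_assoc[symmetric] by (rule restrict_comp_in_local_configs)
  then show "global_rule N \<gamma> (pullback f d) x = pullback f (global_rule N \<delta> d) x"
    by (simp add: global_rule_def pullback_def pre_cellular_morphism_apply[OF assms] o_assoc)
qed

lemma satisfies_pullback:
  assumes "pre_cellular_morphism N \<gamma> \<delta> f"
  shows "satisfies N \<gamma> \<phi> x (pullback f d) \<longleftrightarrow> satisfies N \<delta> \<phi> (f x) d"
\<comment> \<open>\<open>Dia\<close> moves the point to \<open>fst (\<gamma> x) m\<close>, which
  \<open>f\<close> sends to \<open>fst (\<delta> (f x)) m\<close>; \<open>Next\<close> replaces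
  \<open>d\<close> by \<open>global_rule N \<delta> d\<close>. Hence both must vary.\<close>
proof (induction \<phi> arbitrary: x d)
  case (State s)
  show ?case by (simp add: pullback_def)
next
  case (Dia m \<phi>)
  then show ?case by (simp add: pre_cellular_morphism_apply[OF assms])
next
  case (Next \<phi>)
  then show ?case by (simp add: global_rule_pullback[OF assms])
qed auto

theorem theorem1:
  fixes N :: "'m::monoid_mult set"
    and \<gamma> :: "'x \<Rightarrow> ('m, 'x, 's) cell" and x0 :: 'x
    and \<delta> :: "'y \<Rightarrow> ('m, 'y, 's) cell" and y0 :: 'y
    and f :: "'x \<Rightarrow> 'y" and s :: "('x, 's) config \<Rightarrow> ('y, 's) config"
  assumes "cellular_automaton N \<gamma>"
    and "cellular_automaton N \<delta>"
    and "based_cellular_morphism N (\<gamma>, x0) (\<delta>, y0) (f, s)"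
  shows "logical_transport TYPE('j) N (\<gamma>, x0) (\<delta>, y0) s"
proof -
  from assms(3) have f: "pre_cellular_morphism N \<gamma> \<delta> f" and s: "pullback f \<circ> s = id"
    and y0: "f x0 = y0"
    by (auto simp: based_cellular_morphism_def cellular_morphism_def)
  have "pullback f (s c) = c" for c
    using fun_cong[OF s, of c] by simp
  then have "satisfies N \<gamma> \<phi> x0 c \<longleftrightarrow> satisfies N \<delta> \<phi> y0 (s c)"
    for \<phi> :: "('s, 'm, 'j) modal_formula" and c
    using satisfies_pullback[OF f, of \<phi> x0 "s c"] y0 by simp
  then show ?thesis
    by (simp add: logical_transport_def)
qed

end
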